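(* Let $q$ be a prime power. If $s$ is an integer such that $q^2+q+2\le s\le q^2+2q+2$, then $\mu(s)=f(s)=q+1$, where $f(n)=\left\lceil \frac{1}{2}\left(\sqrt{4n-3}-1\right)\right\rceil$ and $\mu(n)$ is the $n$th mediation number.
   Context: Digraphs are finite, without loops or parallel arcs (both arcs $xy$ and $yx$ may be present). For a digraph $D$ and a vertex $x$, let $N^-(x)=\{y: yx\in A(D)\}$ and $N^-[x]=\{x\}\cup N^-(x)$; $\Delta^-(D)$ is the maximum of $|N^-(x)|$ over vertices $x$. A digraph $D$ is mediated if for every pair $x,y$ of distinct vertices there is a vertex $z$ (possibly $z=x$ or $z=y$) such that $x,y\in N^-[z]$. For $n\ge 1$, the $n$th mediation number $\mu(n)$ is the minimum of $\Delta^-(D)$ over all mediated digraphs $D$ on $n$ vertices. A prime power is an integer $p^k$ with $p$ prime and $k\ge 1$. *)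

theory Defs
  imports
    Complex_Main
    "HOL-Number_Theory.Prime_Powers"
    "Graph_Theory.Digraph"
begin

definition in_nbhd :: "('a, 'b) pre_digraph \<Rightarrow> 'a \<Rightarrow> 'a set" where
  "in_nbhd D x = {y. y \<rightarrow>\<^bsub>D\<^esub> x}"

definition closed_in_nbhd :: "('a, 'b) pre_digraph \<Rightarrow> 'a \<Rightarrow> 'a set" where
  "closed_in_nbhd D x = insert x (in_nbhd D x)"

definition max_in_degree :: "('a, 'b) pre_digraph \<Rightarrow> nat" where
  "max_in_degree D = Max ((\<lambda>x. card (in_nbhd D x)) ` verts D)"

text \<open>The locale \<open>digraph\<close> is that of finite digraphs without loops or parallel
  arcs; opposite arcs are allowed.\<close>

definition mediated :: "('a, 'b) pre_digraph \<Rightarrow> bool" where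
  "mediated D \<longleftrightarrow> digraph D \<and>
     (\<forall>x\<in>verts D. \<forall>y\<in>verts D. x \<noteq> y \<longrightarrow>
        (\<exists>z\<in>verts D. x \<in> closed_in_nbhd D z \<and> y \<in> closed_in_nbhd D z))"

text \<open>Every finite digraph is isomorphic to one with natural numbers as vertices and
  pairs of them as arcs, so fixing these types loses no generality. For \<open>n \<ge> 1\<close> the
  set of values over which the minimum is taken is nonempty, because the complete
  digraph on \<open>n\<close> vertices is mediated; the value at \<open>n = 0\<close> is irrelevant.\<close>

definition mediation_number :: "nat \<Rightarrow> nat" where
  "mediation_number n =
     (LEAST d. \<exists>D :: (nat, nat \<times> nat) pre_digraph.
        mediated D \<and> card (verts D) = n \<and> max_in_degree D = d)"

definition mediation_bound :: "nat \<Rightarrow> int" where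
  "mediation_bound n = \<lceil>(1 / 2) * (sqrt (4 * real n - 3) - 1)\<rceil>"

end

theory Submission
  imports
    Defs
    "HOL-Algebra.Algebraic_Closure"
    "HOL-Number_Theory.Residues"
begin

text \<open>
  A mediated digraph amounts to a family of blocks covering all pairs of vertices, together with
  a bijection that assigns to each vertex a block containing it. Double counting pairs gives
  \<open>n - 1 \<le> \<Delta>(\<Delta> + 1)\<close>, hence \<open>\<Delta> \<ge> q + 1\<close> in the given range. For the converse, take the projective
  plane of order \<open>q\<close> and \<open>k \<le> q + 1\<close> new points, one for each of \<open>k\<close> points at infinity. Every
  affine line is extended by the new point belonging to its direction, the line at infinity is
  replaced by \<open>k\<close> copies, each extended by one new point, and one last block consists of all new
  points. The blocks have at most \<open>q + 2\<close> elements, and there are as many of them as points.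
\<close>

section \<open>Digraphs and blocks\<close>

text \<open>Removing \<open>z\<close> from \<open>B z\<close> excludes loops; if
  \<open>z \<in> B z\<close>, the closed in-neighbourhood of \<open>z\<close> is exactly
  \<open>B z\<close>.\<close>

definition block_digraph :: "nat set \<Rightarrow> (nat \<Rightarrow> nat set) \<Rightarrow> (nat, nat \<times> nat) pre_digraph" where
  "block_digraph V B =
     \<lparr>verts = V, arcs = {(y, z). z \<in> V \<and> y \<in> B z - {z}}, tail = fst, head = snd\<rparr>"

lemma in_nbhd_block_digraph:
  "z \<in> V \<Longrightarrow> in_nbhd (block_digraph V B) z = B z - {z}"
  by (auto simp: in_nbhd_def block_digraph_def arcs_ends_def arc_to_ends_def image_iff)

lemma digraph_block_digraph:
  assumes "finite V" "\<And>z. z \<in> V \<Longrightarrow> B z \<subseteq> V"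
  shows "digraph (block_digraph V B)"
proof -
  have "arcs (block_digraph V B) \<subseteq> V \<times> V"
    using assms(2) by (auto simp: block_digraph_def)
  then have "finite (arcs (block_digraph V B))"
    using assms(1) by (meson finite_SigmaI finite_subset)
  then show ?thesis
    using assms subsetD[OF assms(2)] by unfold_locales (auto simp: block_digraph_def arc_to_ends_def)
qed

lemma in_nbhd_subset:
  assumes "digraph D"
  shows "in_nbhd D x \<subseteq> verts D - {x}"
proof -
  interpret digraph D by (rule assms)
  show ?thesis
    by (auto simp: in_nbhd_def arcs_ends_def arc_to_ends_def dest: no_loops)
qed

lemma card_in_nbhd_le_max_in_degree:
  assumes "digraph D" "x \<in> verts D"
  shows "card (in_nbhd D x) \<le> max_in_degree D"
proof -
  interpret digraph D by (rule assms)
  show ?thesis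
    using assms(2) by (auto simp: max_in_degree_def)
qed

text \<open>Because \<open>z \<in> B z\<close>, blocks become closed in-neighbourhoods, so covering
  turns into mediation and in-degrees are block sizes minus one. An injection into
  \<open>nat\<close> moves the family to the vertex type used by
  \<open>mediation_number\<close>.\<close>

lemma exists_mediated_of_blocks:
  fixes V :: "'v set" and B :: "'v \<Rightarrow> 'v set"
  assumes "finite V" "V \<noteq> {}"
    and B: "\<And>z. z \<in> V \<Longrightarrow> z \<in> B z \<and> B z \<subseteq> V \<and> card (B z) \<le> Suc d"
    and cover: "\<And>x y. x \<in> V \<Longrightarrow> y \<in> V \<Longrightarrow> \<exists>z\<in>V. x \<in> B z \<and> y \<in> B z"
  shows "\<exists>D :: (nat, nat \<times> nat) pre_digraph.
    mediated D \<and> card (verts D) = card V \<and> max_in_degree D \<le> d"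
proof -
  obtain f :: "'v \<Rightarrow> nat" where f: "inj_on f V"
    using finite_imp_inj_to_nat_seg[OF \<open>finite V\<close>] by blast
  define g where "g = inv_into V f"
  have gf: "g (f v) = v" if "v \<in> V" for v
    unfolding g_def using f that by simp
  define D where "D = block_digraph (f ` V) (\<lambda>z. f ` B (g z))"
  have verts: "verts D = f ` V"
    by (simp add: D_def block_digraph_def)
  have nbhd: "in_nbhd D (f v) = f ` B v - {f v}" if "v \<in> V" for v
    using that unfolding D_def by (simp add: in_nbhd_block_digraph gf)
  have "digraph D"
    unfolding D_def
  proof (rule digraph_block_digraph)
    show "f ` B (g z) \<subseteq> f ` V" if "z \<in> f ` V" for z
      using that B by (metis gf image_iff image_mono)
  qed (use \<open>finite V\<close> in simp)
  moreover have "closed_in_nbhd D (f v) = f ` B v" if "v \<in> V" for v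
    using that B[OF that] by (auto simp: closed_in_nbhd_def nbhd)
  ultimately have "mediated D"
    unfolding mediated_def verts using cover by fastforce
  moreover have "card (in_nbhd D (f v)) \<le> d" if "v \<in> V" for v
  proof -
    have "finite (B v)"
      using B[OF that] \<open>finite V\<close> finite_subset by blast
    then have "card (f ` B v - {f v}) \<le> card (B v) - 1"
      using B[OF that] by (simp add: card_Diff_singleton card_image_le diff_le_mono)
    also have "card (B v) - 1 \<le> d"
      using B[OF that] by (simp add: le_diff_conv)
    finally show ?thesis
      using nbhd[OF that] by simp
  qed
  then have "max_in_degree D \<le> d"
    unfolding max_in_degree_def verts using assms(1,2) by auto
  ultimately show ?thesis
    using verts f by (metis card_image)
qed

section \<open>Lower bound by counting ordered pairs\<close>

lemma card_off_diagonal: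
  "finite A \<Longrightarrow> card {(x, y). x \<in> A \<and> y \<in> A \<and> x \<noteq> y} = card A * (card A - 1)"
proof -
  assume "finite A"
  have "{(x, y). x \<in> A \<and> y \<in> A \<and> x \<noteq> y} = (SIGMA x:A. A - {x})"
    by auto
  then show ?thesis
    using \<open>finite A\<close> by (simp add: card_SigmaI)
qed

text \<open>Mediation says that the \<open>n\<close> closed in-neighbourhoods cover all
  \<open>n * (n - 1)\<close> ordered pairs of distinct vertices. Each of them holds at most
  \<open>(d + 1) * d\<close> such pairs; then \<open>n\<close> cancels.\<close>

lemma mediated_card_le:
  assumes "mediated D" "verts D \<noteq> {}"
  shows "card (verts D) - 1 \<le> (max_in_degree D + 1) * max_in_degree D"
proof -
  let ?P = "\<lambda>A. {(x, y). x \<in> A \<and> y \<in> A \<and> x \<noteq> y}"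
  have D: "digraph D"
    using assms by (simp add: mediated_def)
  interpret digraph D by (rule D)
  let ?n = "card (verts D)" and ?d = "max_in_degree D"
  have fin: "finite (in_nbhd D z)" for z
    using in_nbhd_subset[OF D, of z] finite_verts by (meson finite_Diff finite_subset)
  have card_P: "card (?P (closed_in_nbhd D z)) \<le> (?d + 1) * ?d" if z: "z \<in> verts D" for z
  proof -
    have "z \<notin> in_nbhd D z"
      using in_nbhd_subset[OF D] by auto
    then have "card (closed_in_nbhd D z) \<le> ?d + 1"
      using card_in_nbhd_le_max_in_degree[OF D z] fin by (simp add: closed_in_nbhd_def)
    then have "card (closed_in_nbhd D z) * (card (closed_in_nbhd D z) - 1) \<le> (?d + 1) * ?d"
      by (intro mult_le_mono) auto
    then show ?thesis
      using fin by (subst card_off_diagonal) (auto simp: closed_in_nbhd_def)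
  qed
  have "?P (verts D) \<subseteq> (\<Union>z\<in>verts D. ?P (closed_in_nbhd D z))"
    using assms(1) unfolding mediated_def by auto
  moreover have "finite (\<Union>z\<in>verts D. ?P (closed_in_nbhd D z))"
  proof (intro finite_UN_I finite_verts)
    fix z
    have "finite (closed_in_nbhd D z \<times> closed_in_nbhd D z)"
      using fin by (simp add: closed_in_nbhd_def)
    then show "finite (?P (closed_in_nbhd D z))"
      by (rule finite_subset[rotated]) auto
  qed
  ultimately have "card (?P (verts D)) \<le> card (\<Union>z\<in>verts D. ?P (closed_in_nbhd D z))"
    by (rule card_mono[rotated])
  also have "\<dots> \<le> (\<Sum>z\<in>verts D. card (?P (closed_in_nbhd D z)))"
    by (rule card_UN_le) simp
  also have "\<dots> \<le> (\<Sum>z\<in>verts D. (?d + 1) * ?d)"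
    by (rule sum_mono) (rule card_P)
  finally have "?n * (?n - 1) \<le> ?n * ((?d + 1) * ?d)"
    by (simp add: card_off_diagonal)
  moreover have "0 < ?n"
    using assms(2) by (simp add: card_gt_0_iff)
  ultimately show ?thesis
    by (simp only: mult_le_cancel1)
qed

section \<open>The extended plane\<close>

text \<open>\<open>Slope m\<close> and \<open>Vert\<close> are the points at infinity of the lines of slope \<open>m\<close> and of the vertical
  lines; the new points attached to them are \<open>Ext (m + 1)\<close> and \<open>Ext 0\<close>.\<close>

datatype vertex = Aff nat nat | Slope nat | Vert | Ext nat

text \<open>\<open>T m x b\<close> is to be read as \<open>m x + b\<close> in a coordinate field with \<open>q\<close> elements.\<close>

locale planar_function =
  fixes q :: nat and T :: "nat \<Rightarrow> nat \<Rightarrow> nat \<Rightarrow> nat"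
  assumes q_pos: "0 < q"
    and T_less: "\<lbrakk>m < q; x < q; b < q\<rbrakk> \<Longrightarrow> T m x b < q"
    and T_ex1: "\<lbrakk>m < q; x < q; y < q\<rbrakk> \<Longrightarrow> \<exists>!b. b < q \<and> T m x b = y"
    and T_join: "\<lbrakk>x < q; y < q; x' < q; y' < q; x \<noteq> x'\<rbrakk>
      \<Longrightarrow> \<exists>m<q. \<exists>b<q. T m x b = y \<and> T m x' b = y'"
begin

definition points :: "nat \<Rightarrow> vertex set" where
  "points k = (\<lambda>(x, y). Aff x y) ` ({..<q} \<times> {..<q}) \<union> Slope ` {..<q} \<union> {Vert} \<union> Ext ` {..<k}"

text \<open>New points go to the vertical direction first and then to the slopes in increasing order
  until all \<open>k\<close> are used; later slopes get none.\<close>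

definition line :: "nat \<Rightarrow> nat \<Rightarrow> nat \<Rightarrow> vertex set" where
  "line k m b = (\<lambda>x. Aff x (T m x b)) ` {..<q} \<union> {Slope m} \<union> (if Suc m < k then {Ext (Suc m)} else {})"

definition vline :: "nat \<Rightarrow> vertex set" where
  "vline x = Aff x ` {..<q} \<union> {Vert, Ext 0}"

definition inf_line :: "nat \<Rightarrow> vertex set" where
  "inf_line i = Slope ` {..<q} \<union> {Vert, Ext i}"

text \<open>This describes the line of slope \<open>m\<close> through \<open>Aff m y\<close>. Taking
  the abscissa as slope lets each affine point select one non-vertical line.\<close>

definition intercept :: "nat \<Rightarrow> nat \<Rightarrow> nat" where
  "intercept m y = (THE b. b < q \<and> T m m b = y)"

text \<open>The assignment of blocks to points rests on the bijection \<open>(m, b) \<mapsto> (m, T m m b)\<close>, which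
  picks a point on each non-vertical line. The lines with \<open>b = 0\<close> are instead assigned to their
  points at infinity, so that the affine points \<open>(x, T x x 0)\<close> are left for the vertical lines.\<close>

fun block :: "nat \<Rightarrow> vertex \<Rightarrow> vertex set" where
  "block k (Aff x y) = (if intercept x y = 0 then vline x else line k x (intercept x y))"
| "block k (Slope m) = line k m 0"
| "block k Vert = inf_line 0"
| "block k (Ext i) = (if i = 0 then Ext ` {..<k} else inf_line i)"

section \<open>The assignment of blocks to points\<close>

lemma intercept:
  assumes "m < q" "y < q"
  shows "intercept m y < q" "T m m (intercept m y) = y"
  using theI'[OF T_ex1[OF assms(1,1,2)]] by (auto simp: intercept_def)

lemma intercept_eq:
  assumes "m < q" "b < q"
  shows "intercept m (T m m b) = b"
  using intercept[of m "T m m b"] T_ex1[of m m "T m m b"] T_less assms by blast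

lemma in_points [simp]:
  "Aff x y \<in> points k \<longleftrightarrow> x < q \<and> y < q"
  "Slope m \<in> points k \<longleftrightarrow> m < q"
  "Vert \<in> points k"
  "Ext i \<in> points k \<longleftrightarrow> i < k"
  by (auto simp: points_def)

lemma finite_points: "finite (points k)"
  by (simp add: points_def)

lemma card_points: "card (points k) = q\<^sup>2 + q + 1 + k"
proof -
  have "card ((\<lambda>(x, y). Aff x y) ` ({..<q} \<times> {..<q})) = q\<^sup>2"
    by (subst card_image) (auto simp: inj_on_def power2_eq_square)
  moreover have "card (Slope ` {..<q}) = q" "card (Ext ` {..<k}) = k"
    by (simp_all add: card_image inj_on_def)
  ultimately show ?thesis
    unfolding points_def by (subst card_Un_disjoint; (subst card_Un_disjoint)?; auto)+
qed

lemma card_insert_pair_le: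
  assumes "card A \<le> q" shows "card (A \<union> {u, v}) \<le> q + 2"
  using card_Un_le[of A "{u, v}"] card_insert_le_m1[of 2 "{v}" u] assms by simp

lemma card_line: "card (line k m b) \<le> q + 2"
proof -
  have "line k m b \<subseteq> (\<lambda>x. Aff x (T m x b)) ` {..<q} \<union> {Slope m, Ext (Suc m)}"
    by (auto simp: line_def)
  then have "card (line k m b) \<le> card ((\<lambda>x. Aff x (T m x b)) ` {..<q} \<union> {Slope m, Ext (Suc m)})"
    by (intro card_mono) auto
  also have "\<dots> \<le> q + 2"
    by (rule card_insert_pair_le) (use card_image_le[of "{..<q}"] in auto)
  finally show ?thesis .
qed

lemma card_vline: "card (vline x) \<le> q + 2"
  unfolding vline_def by (rule card_insert_pair_le) (use card_image_le[of "{..<q}"] in auto)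

lemma card_inf_line: "card (inf_line i) \<le> q + 2"
  unfolding inf_line_def by (rule card_insert_pair_le) (use card_image_le[of "{..<q}"] in auto)

text \<open>An affine point lies on the line it selects, by the choice of \<open>intercept\<close>,
  and on its vertical line. The condition \<open>0 < k\<close> puts \<open>Ext 0\<close>, a member
  of all vertical lines and of \<open>inf_line 0\<close>, among the points.\<close>

lemma block_valid:
  assumes k: "0 < k" "k \<le> q + 1" and z: "z \<in> points k"
  shows "z \<in> block k z \<and> block k z \<subseteq> points k \<and> card (block k z) \<le> q + 2"
proof (intro conjI)
  show "z \<in> block k z"
    using z intercept(2) q_pos
    by (cases z) (auto simp: vline_def line_def inf_line_def)
  have "line k m b \<subseteq> points k" if "m < q" "b < q" for m b
    using that T_less by (auto simp: line_def)
  moreover have "vline x \<subseteq> points k" if "x < q" for x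
    using that k by (auto simp: vline_def)
  moreover have "inf_line i \<subseteq> points k" if "i < k" for i
    using that by (auto simp: inf_line_def)
  ultimately show "block k z \<subseteq> points k"
    using z k q_pos intercept(1) by (cases z) auto
  have "card (Ext ` {..<k}) \<le> q + 2"
    using k card_image_le[of "{..<k}" Ext] by simp
  then show "card (block k z) \<le> q + 2"
    by (cases z) (simp_all add: card_line[simplified] card_vline[simplified] card_inf_line[simplified])
qed

text \<open>This and the next two lemmas show that no line is lost in the assignment, so a pair is
  joined as soon as it lies on a common line.\<close>

lemma line_is_block:
  assumes "m < q" "b < q"
  shows "\<exists>z\<in>points k. block k z = line k m b"
proof (cases "b = 0")
  case True
  then show ?thesis
    using assms by (intro bexI[of _ "Slope m"]) auto
next
  case False
  then show ?thesis
    using assms T_less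
    by (intro bexI[of _ "Aff m (T m m b)"]) (auto simp: intercept_eq)
qed

lemma vline_is_block:
  assumes "x < q"
  shows "\<exists>z\<in>points k. block k z = vline x"
  using assms T_less q_pos
  by (intro bexI[of _ "Aff x (T x x 0)"]) (auto simp: intercept_eq)

lemma inf_line_is_block:
  assumes "i < k"
  shows "\<exists>z\<in>points k. block k z = inf_line i"
proof (cases "i = 0")
  case True
  then show ?thesis
    by (intro bexI[of _ Vert]) auto
next
  case False
  then show ?thesis
    using assms by (intro bexI[of _ "Ext i"]) auto
qed

section \<open>Every pair of points lies in a block\<close>

abbreviation joined :: "nat \<Rightarrow> vertex \<Rightarrow> vertex \<Rightarrow> bool" where
  "joined k u v \<equiv> \<exists>z\<in>points k. u \<in> block k z \<and> v \<in> block k z"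

lemma joined_by_line:
  "\<lbrakk>u \<in> line k m b; v \<in> line k m b; m < q; b < q\<rbrakk> \<Longrightarrow> joined k u v"
  using line_is_block by metis

lemma joined_by_vline: "\<lbrakk>u \<in> vline x; v \<in> vline x; x < q\<rbrakk> \<Longrightarrow> joined k u v"
  using vline_is_block by metis

lemma joined_by_inf_line: "\<lbrakk>u \<in> inf_line i; v \<in> inf_line i; i < k\<rbrakk> \<Longrightarrow> joined k u v"
  using inf_line_is_block by metis

text \<open>An affine point is on a line of every direction, and that line also contains the point
  at infinity and the new point, if any, of its direction.\<close>

lemma joined_Aff:
  assumes x: "x < q" and y: "y < q" and k: "0 < k" "k \<le> q + 1" and v: "v \<in> points k"
  shows "joined k (Aff x y) v"
proof -
  have through: "\<exists>b<q. Aff x y \<in> line k m b" if "m < q" for m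
    using T_ex1[OF that x y] x by (auto simp: line_def)
  show ?thesis
  proof (cases v)
    case (Aff x' y')
    then have xy': "x' < q" "y' < q"
      using v by auto
    show ?thesis
    proof (cases "x = x'")
      case True
      show ?thesis
        by (rule joined_by_vline[of _ x]) (use True Aff x y xy' in \<open>auto simp: vline_def\<close>)
    next
      case False
      then obtain m b where "m < q" "b < q" "T m x b = y" "T m x' b = y'"
        using T_join x y xy' by metis
      then show ?thesis
        by (intro joined_by_line[of _ k m b]) (use Aff x xy' in \<open>auto simp: line_def\<close>)
    qed
  next
    case (Slope m)
    with v have m: "m < q"
      by auto
    with through obtain b where "b < q" "Aff x y \<in> line k m b"
      by blast
    then show ?thesis
      by (intro joined_by_line[of _ k m b]) (use Slope m in \<open>auto simp: line_def\<close>)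
  next
    case Vert
    show ?thesis
      by (rule joined_by_vline[of _ x]) (use Vert x y in \<open>auto simp: vline_def\<close>)
  next
    case (Ext i)
    show ?thesis
    proof (cases i)
      case 0
      show ?thesis
        by (rule joined_by_vline[of _ x]) (use 0 Ext x y in \<open>auto simp: vline_def\<close>)
    next
      case (Suc m)
      \<comment> \<open>Here \<open>k \<le> q + 1\<close> enters: there are at most as many new
        points as directions, so \<open>Ext (Suc m)\<close> belongs to a genuine slope
        \<open>m\<close>.\<close>
      with v k Ext have m: "m < q" "Suc m < k"
        by auto
      with through obtain b where "b < q" "Aff x y \<in> line k m b"
        by blast
      then show ?thesis
        by (intro joined_by_line[of _ k m b]) (use Ext Suc m in \<open>auto simp: line_def\<close>)
    qed
  qed
qed

text \<open>Two new points meet in the block of \<open>Ext 0\<close>. A pair without affine points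
  and with at most one new point lies in the copy of the line at infinity that carries this new
  point, or in copy \<open>0\<close> if there is none.\<close>

lemma joined_all:
  assumes k: "0 < k" "k \<le> q + 1" and u: "u \<in> points k" and v: "v \<in> points k"
  shows "joined k u v"
proof -
  consider x y where "u = Aff x y" | x y where "v = Aff x y"
    | i j where "u = Ext i" "v = Ext j"
    | "\<exists>i<k. u \<in> inf_line i \<and> v \<in> inf_line i"
    using u v k by (cases u; cases v) (auto simp: inf_line_def)
  then show ?thesis
  proof cases
    case (1 x y)
    then have "x < q" "y < q"
      using u by auto
    then show ?thesis
      unfolding 1 by (rule joined_Aff[OF _ _ k v])
  next
    case (2 x y)
    then have "x < q" "y < q"
      using v by auto
    then show ?thesis
      using joined_Aff[OF _ _ k u] unfolding 2 by blast
  next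
    case 3
    then show ?thesis
      using u v k by (intro bexI[of _ "Ext 0"]) auto
  next
    case 4
    then show ?thesis
      using joined_by_inf_line by blast
  qed
qed

theorem exists_mediated:
  assumes "0 < k" "k \<le> q + 1"
  shows "\<exists>D :: (nat, nat \<times> nat) pre_digraph.
    mediated D \<and> card (verts D) = q\<^sup>2 + q + 1 + k \<and> max_in_degree D \<le> q + 1"
proof -
  have "points k \<noteq> {}"
    by (simp add: points_def)
  then show ?thesis
    using exists_mediated_of_blocks[of "points k" "block k" "q + 1"]
      finite_points block_valid[OF assms] joined_all[OF assms]
    unfolding card_points by simp
qed

end

text \<open>The ceiling is \<open>q + 1\<close> exactly when
  \<open>(2 * q + 1)^2 < 4 * s - 3 \<le> (2 * q + 3)^2\<close>, and dividing by 4 gives the assumed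
  range of \<open>s\<close>.\<close>

lemma mediation_bound_eq:
  fixes q s :: nat
  assumes "q\<^sup>2 + q + 2 \<le> s" "s \<le> q\<^sup>2 + 3 * q + 3"
  shows "mediation_bound s = int q + 1"
proof -
  have "real (q\<^sup>2 + q + 2) \<le> real s" "real s \<le> real (q\<^sup>2 + 3 * q + 3)"
    using assms of_nat_mono by blast+
  then have s: "(real q)\<^sup>2 + real q + 2 \<le> real s" "real s \<le> (real q)\<^sup>2 + 3 * real q + 3"
    by simp_all
  have "2 * real q + 1 < sqrt (4 * real s - 3)"
    by (rule real_less_rsqrt) (use s in \<open>simp add: power2_eq_square algebra_simps\<close>)
  moreover have "sqrt (4 * real s - 3) \<le> 2 * real q + 3"
    by (rule real_le_lsqrt) (use s in \<open>simp_all add: power2_eq_square algebra_simps\<close>)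
  ultimately show ?thesis
    unfolding mediation_bound_def by (intro ceiling_unique) auto
qed


section \<open>Finite fields\<close>

lemma (in cring) binomial_expansion:
  assumes x: "x \<in> carrier R" and y: "y \<in> carrier R"
  shows "(x \<oplus> y) [^] n = (\<Oplus>i\<in>{..n}. add_pow R (n choose i) (x [^] i \<otimes> y [^] (n - i)))"
proof (induction n)
  case 0
  then show ?case by simp
next
  case (Suc n)
  define t where "t i = x [^] i \<otimes> y [^] (Suc n - i)" for i
  \<comment> \<open>Multiplication by \<open>x\<close> shifts the row of Pascal's triangle by one.
    The entry at \<open>0\<close> is set separately, since truncated subtraction would give
    \<open>n choose 0 = 1\<close> there.\<close>
  define c where "c i = (if i = 0 then 0 else n choose (i - 1))" for i
  have t: "t i \<in> carrier R" for i
    unfolding t_def using x y by auto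
  let ?S = "\<Oplus>i\<in>{..n}. add_pow R (n choose i) (x [^] i \<otimes> y [^] (n - i))"
  have S: "?S \<in> carrier R"
    by (rule finsum_closed) (use x y in auto)
  have "?S \<otimes> x = (\<Oplus>i\<in>{..n}. add_pow R (c (Suc i)) (t (Suc i)))"
    unfolding t_def c_def using x y
    by (subst finsum_ldistr) (auto intro!: finsum_cong' simp: add_pow_ldistr add_pow_rdistr m_ac)
  also have "\<dots> = (\<Oplus>i\<in>{..Suc n}. add_pow R (c i) (t i))"
    using t by (subst finsum_Suc2) (auto simp: c_def intro!: finsum_closed)
  finally have 1: "?S \<otimes> x = (\<Oplus>i\<in>{..Suc n}. add_pow R (c i) (t i))" .
  have "?S \<otimes> y = (\<Oplus>i\<in>{..n}. add_pow R (n choose i) (t i))"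
    unfolding t_def using x y
    by (subst finsum_ldistr) (auto intro!: finsum_cong' simp: add_pow_ldistr m_assoc Suc_diff_le)
  \<comment> \<open>The added term vanishes because \<open>n choose Suc n = 0\<close>; both sums now
    range over the same monomials and combine by Pascal's rule.\<close>
  also have "\<dots> = (\<Oplus>i\<in>{..Suc n}. add_pow R (n choose i) (t i))"
    using t by (subst finsum_Suc) (auto simp: binomial_eq_0 intro!: finsum_closed)
  finally have 2: "?S \<otimes> y = (\<Oplus>i\<in>{..Suc n}. add_pow R (n choose i) (t i))" .
  have "(x \<oplus> y) [^] Suc n = ?S \<otimes> x \<oplus> ?S \<otimes> y"
    using S x y by (simp add: Suc.IH r_distr)
  also have "\<dots> = (\<Oplus>i\<in>{..Suc n}. add_pow R (c i) (t i) \<oplus> add_pow R (n choose i) (t i))"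
    unfolding 1 2 by (subst finsum_addf) (use t in auto)
  also have "\<dots> = (\<Oplus>i\<in>{..Suc n}. add_pow R (Suc n choose i) (t i))"
  proof (rule finsum_cong', goal_cases)
    case (3 i)
    have "c i + (n choose i) = Suc n choose i"
      by (cases i) (auto simp: c_def)
    then show ?case
      using t by (metis add.nat_pow_mult)
  qed (use t in auto)
  finally show ?case
    unfolding t_def .
qed

lemma (in cring) add_pow_eq_zero_of_dvd:
  assumes "add_pow R (p::nat) \<one> = \<zero>" "p dvd n" "x \<in> carrier R"
  shows "add_pow R n x = \<zero>"
proof -
  from assms(2) obtain m where n: "n = p * m" by blast
  have "add_pow R n x = (add_pow R n \<one>) \<otimes> x"
    using assms(3) by (simp add: add_pow_ldistr)
  also have "add_pow R n \<one> = add_pow R m (add_pow R p \<one>)"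
    unfolding n by (simp add: add.nat_pow_pow)
  finally show ?thesis
    using assms by (simp add: add.nat_pow_one)
qed

text \<open>For \<open>0 < i < p\<close> the coefficient \<open>p choose i\<close> is divisible by
  \<open>p\<close>, so only the two extreme terms of the binomial expansion survive.\<close>

lemma (in cring) frobenius_add:
  assumes p: "Factorial_Ring.prime p" and char: "add_pow R (p::nat) \<one> = \<zero>"
    and x: "x \<in> carrier R" and y: "y \<in> carrier R"
  shows "(x \<oplus> y) [^] p = x [^] p \<oplus> y [^] p"
proof -
  obtain m where m: "p = Suc m"
    using p prime_gt_0_nat by (cases p) auto
  define u where "u i = add_pow R (p choose i) (x [^] i \<otimes> y [^] (p - i))" for i
  have u: "u i \<in> carrier R" for i
    unfolding u_def using x y by auto
  have "u i = \<zero>" if "0 < i" "i < p" for i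
    unfolding u_def using that p x y
    by (intro add_pow_eq_zero_of_dvd[OF char]) (auto intro: dvd_choose_prime)
  then have "(\<Oplus>i\<in>{..m}. u i) = (\<Oplus>i\<in>{..m}. if i = 0 then u 0 else \<zero>)"
    by (intro finsum_cong') (auto simp: u m)
  also have "\<dots> = u 0"
    using u finsum_singleton[of 0 "{..m}" u] by (auto simp: eq_commute[of 0] cong: if_cong)
  finally have "(\<Oplus>i\<in>{..m}. u i) = u 0" .
  then have "(\<Oplus>i\<in>{..p}. u i) = u p \<oplus> u 0"
    unfolding m using u by (subst finsum_Suc) auto
  then show ?thesis
    unfolding binomial_expansion[OF x y] u_def using x y by simp
qed

lemma (in cring) frobenius_pow_add:
  assumes "Factorial_Ring.prime p" "add_pow R (p::nat) \<one> = \<zero>" "x \<in> carrier R" "y \<in> carrier R"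
  shows "(x \<oplus> y) [^] (p ^ k) = x [^] (p ^ k) \<oplus> y [^] (p ^ k)"
proof (induction k)
  case (Suc k)
  have "z [^] (p ^ Suc k) = (z [^] (p ^ k)) [^] p" if "z \<in> carrier R" for z
    using that by (simp add: nat_pow_pow mult.commute)
  then show ?case
    using assms Suc by (simp add: frobenius_add)
qed (use assms in simp)

text \<open>Additivity applied to \<open>(x \<ominus> y) \<oplus> y\<close> avoids computing the
  sign of a power of \<open>\<ominus> y\<close>, which would separate \<open>p = 2\<close> from odd
  \<open>p\<close>.\<close>

lemma (in cring) frobenius_pow_minus:
  assumes "Factorial_Ring.prime p" "add_pow R (p::nat) \<one> = \<zero>" "x \<in> carrier R" "y \<in> carrier R"
  shows "(x \<ominus> y) [^] (p ^ k) = x [^] (p ^ k) \<ominus> y [^] (p ^ k)"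
proof -
  have "x [^] (p ^ k) = ((x \<ominus> y) \<oplus> y) [^] (p ^ k)"
    using assms by (simp add: a_minus_def a_assoc l_neg)
  also have "\<dots> = (x \<ominus> y) [^] (p ^ k) \<oplus> y [^] (p ^ k)"
    using assms by (intro frobenius_pow_add) auto
  finally show ?thesis
    using assms by (simp add: a_minus_def a_assoc r_neg)
qed

section \<open>Fixed points of Frobenius in an algebraically closed field\<close>

lemma (in ring_hom_ring) hom_add_pow:
  assumes "x \<in> carrier R"
  shows "h (add_pow R (n::nat) x) = add_pow S n (h x)"
  by (induction n) (use assms in auto)

text \<open>The fixed points are the roots of \<open>X^q - X\<close>, which splits and so has
  \<open>q\<close> roots with multiplicity. All roots are simple, so they are also \<open>q\<close>
  in number as a set.\<close>

lemma (in algebraically_closed) card_frobenius_fixpoints: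
  assumes p: "Factorial_Ring.prime p" and char: "add_pow L (p::nat) \<one> = \<zero>" and k: "0 < k"
  shows "card {x \<in> carrier L. x [^] (p ^ k) = x} = p ^ k"
proof -
  define q where "q = p ^ k"
  have "1 < q"
    unfolding q_def using p k by (metis one_less_power prime_gt_1_nat)
  let ?P = "poly_ring L"
  interpret UP: domain ?P
    using univ_poly_is_domain[OF carrier_is_subring] .
  have hom: "ring_hom_ring L ?P poly_of_const"
    using canonical_embedding_ring_hom[OF carrier_is_subring] by simp
  interpret C: ring_hom_ring L ?P poly_of_const
    by (rule hom)
  \<comment> \<open>The polynomial ring inherits the characteristic, so the Frobenius identities
    hold for polynomials too.\<close>
  have charP: "add_pow ?P p \<one>\<^bsub>?P\<^esub> = \<zero>\<^bsub>?P\<^esub>"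
    using C.hom_add_pow[of \<one> p] char by simp
  have X: "X \<in> carrier ?P"
    by (rule var_closed(1)[OF carrier_is_subring])
  define f where "f = X [^]\<^bsub>?P\<^esub> q \<ominus>\<^bsub>?P\<^esub> X"
  have f: "f \<in> carrier ?P"
    unfolding f_def using X by simp
  have degX: "degree X = 1"
    by (simp add: var_def)
  have "degree (X [^]\<^bsub>?P\<^esub> q) = q" "degree (\<ominus>\<^bsub>?P\<^esub> X) = 1"
    unfolding polynomial_pow_degree[OF X] univ_poly_a_inv_degree[OF carrier_is_subring X] degX
    by simp_all
  moreover have "polynomial\<^bsub>L\<^esub> (carrier L) (X [^]\<^bsub>?P\<^esub> q)" "polynomial\<^bsub>L\<^esub> (carrier L) (\<ominus>\<^bsub>?P\<^esub> X)"
    using X by (simp_all add: univ_poly_carrier)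
  \<comment> \<open>As \<open>1 < q\<close>, the two summands have different degrees and no leading
    terms cancel.\<close>
  ultimately have degf: "degree f = q"
    using poly_add_degree_eq[OF carrier_is_subring, of "X [^]\<^bsub>?P\<^esub> q" "\<ominus>\<^bsub>?P\<^esub> X"] \<open>1 < q\<close>
    unfolding f_def a_minus_def univ_poly_add by linarith
  then have f0: "f \<noteq> []"
    using \<open>1 < q\<close> by auto
  have eval_f: "eval f a = a [^] q \<ominus> a" if a: "a \<in> carrier L" for a
  proof -
    interpret E: ring_hom_ring ?P L "\<lambda>p. eval p a"
      by (rule eval_ring_hom[OF carrier_is_subring a])
    show ?thesis
      unfolding f_def a_minus_def using X a by (simp add: eval_var E.hom_nat_pow)
  qed
  have roots_f: "set_mset (roots f) = {x \<in> carrier L. x [^] q = x}"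
    using eval_f f0 by (auto simp: roots_mem_iff_is_root[OF f] is_root_def)
  have "count (roots f) a = 1" if "a \<in># roots f" for a
  proof -
    from that have a: "a \<in> carrier L" and aq: "a [^] q = a"
      using roots_f by auto
    \<comment> \<open>This is \<open>X - a\<close>, as a coefficient list with the leading
      coefficient first.\<close>
    define b where "b = [\<one>, \<ominus> a]"
    have b: "b \<in> carrier ?P"
      using a unfolding b_def sym[OF univ_poly_carrier] polynomial_def by auto
    have bX: "b = X \<ominus>\<^bsub>?P\<^esub> poly_of_const a"
    proof -
      have "poly_of_const a \<in> carrier ?P"
        using a by simp
      then show ?thesis
        using a unfolding b_def a_minus_def univ_poly_add
        by (simp add: univ_poly_a_inv_def'[OF carrier_is_subring] var_def poly_of_const_def)
    qed
    have "poly_of_const a [^]\<^bsub>?P\<^esub> q = poly_of_const a"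
      using C.hom_nat_pow[of a q] a aq by simp
    then have "b [^]\<^bsub>?P\<^esub> q = X [^]\<^bsub>?P\<^esub> q \<ominus>\<^bsub>?P\<^esub> poly_of_const a"
      using UP.frobenius_pow_minus[OF p charP X, of "poly_of_const a" k] a
      unfolding bX q_def by simp
    then have fb: "f = b [^]\<^bsub>?P\<^esub> q \<ominus>\<^bsub>?P\<^esub> b"
      unfolding f_def using X C.hom_closed[OF a] UP.nat_pow_closed[OF X, of q] unfolding bX
      by (smt (verit, best) UP.a_comm UP.a_lcomm UP.add.inv_closed UP.l_neg UP.minus_add UP.minus_closed
          UP.minus_eq UP.minus_minus UP.r_zero UP.add.m_assoc)
    \<comment> \<open>By the Frobenius identity \<open>X\<^sup>q - X = (X - a)\<^sup>q - (X - a)\<close>, so \<open>a\<close> is a simple root.\<close>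
    have "\<not> 2 \<le> alg_mult f a"
    proof
      \<comment> \<open>Then \<open>b^2\<close> divides \<open>f = b * (b^(q - 1) - 1)\<close>.
        After cancelling one \<open>b\<close>, evaluation at \<open>a\<close> gives \<open>0\<close>
        on one side and, since \<open>q - 1 > 0\<close>, the value \<open>-1\<close> on the
        other.\<close>
      assume "2 \<le> alg_mult f a"
      then have "(b [^]\<^bsub>?P\<^esub> (2::nat)) pdivides f"
        unfolding b_def by (rule le_alg_mult_imp_pdivides[OF a f])
      then obtain g where g: "g \<in> carrier ?P" and "f = (b [^]\<^bsub>?P\<^esub> (2::nat)) \<otimes>\<^bsub>?P\<^esub> g"
        unfolding pdivides_def by auto
      then have "f = b \<otimes>\<^bsub>?P\<^esub> (b \<otimes>\<^bsub>?P\<^esub> g)"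
        using b by (simp add: numeral_2_eq_2 UP.m_assoc)
      moreover have "f = b \<otimes>\<^bsub>?P\<^esub> (b [^]\<^bsub>?P\<^esub> (q - 1) \<ominus>\<^bsub>?P\<^esub> \<one>\<^bsub>?P\<^esub>)"
      proof -
        have "b [^]\<^bsub>?P\<^esub> q = b \<otimes>\<^bsub>?P\<^esub> b [^]\<^bsub>?P\<^esub> (q - 1)"
          using \<open>1 < q\<close> b by (cases q) (auto simp: UP.m_comm)
        then show ?thesis
          unfolding fb using b by (simp add: a_minus_def UP.r_distr UP.r_minus)
      qed
      moreover have "b \<noteq> \<zero>\<^bsub>?P\<^esub>"
        by (simp add: b_def univ_poly_zero)
      ultimately have "b \<otimes>\<^bsub>?P\<^esub> g = b [^]\<^bsub>?P\<^esub> (q - 1) \<ominus>\<^bsub>?P\<^esub> \<one>\<^bsub>?P\<^esub>"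
        using b g UP.m_lcancel[of b "b \<otimes>\<^bsub>?P\<^esub> g" "b [^]\<^bsub>?P\<^esub> (q - 1) \<ominus>\<^bsub>?P\<^esub> \<one>\<^bsub>?P\<^esub>"] by simp
      moreover have "eval b a = \<zero>"
        using a by (simp add: b_def r_neg)
      moreover interpret E: ring_hom_ring ?P L "\<lambda>p. eval p a"
        by (rule eval_ring_hom[OF carrier_is_subring a])
      have "eval (b \<otimes>\<^bsub>?P\<^esub> g) a = eval b a \<otimes> eval g a"
        and "eval (b [^]\<^bsub>?P\<^esub> (q - 1) \<ominus>\<^bsub>?P\<^esub> \<one>\<^bsub>?P\<^esub>) a = eval b a [^] (q - 1) \<ominus> \<one>"
        using b g by (simp_all add: a_minus_def E.hom_nat_pow)
      ultimately have "\<zero> = \<ominus> \<one>"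
        using \<open>1 < q\<close> g by (simp add: nat_pow_zero a_minus_def)
      then show False
        by (metis a_minus_def minus_zero minus_minus one_closed one_not_zero)
    qed
    then show ?thesis
      using that by (simp add: alg_mult_eq_count_roots[OF f] not_le flip: count_greater_zero_iff)
  qed
  then have "size (roots f) = card (set_mset (roots f))"
    by (simp add: size_multiset_overloaded_eq)
  then show ?thesis
    using roots_over_carrier[OF f] unfolding splitted_def degf roots_f q_def by simp
qed

text \<open>An iterate of Frobenius respects the field operations, so its fixed points are closed
  under them.\<close>

lemma (in algebraically_closed) subfield_frobenius_fixpoints:
  assumes p: "Factorial_Ring.prime p" and char: "add_pow L (p::nat) \<one> = \<zero>"
  shows "subfield {x \<in> carrier L. x [^] (p ^ k) = x} L"
proof (rule subfieldI'[OF subringI], goal_cases)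
  case (3 x)
  have "(\<ominus> x) [^] (p ^ k) = (\<zero> \<ominus> x) [^] (p ^ k)"
    using 3 by (simp add: a_minus_def)
  also have "\<dots> = \<ominus> x"
    using 3 p prime_gt_0_nat[OF p] by (subst frobenius_pow_minus[OF p char]) (auto simp: nat_pow_zero a_minus_def)
  finally show ?case
    using 3 by simp
next
  case (6 x)
  then have x: "x \<in> Units L" "x [^] (p ^ k) = x"
    by (auto simp: field_Units)
  \<comment> \<open>Since \<open>x\<close> is fixed, the second factor may be replaced by its power;
    uniqueness of inverses then shows that \<open>inv x\<close> is fixed.\<close>
  then have "inv x [^] (p ^ k) \<otimes> x = (inv x \<otimes> x) [^] (p ^ k)"
    by (subst nat_pow_distrib) (auto intro: Units_closed)
  also have "\<dots> = \<one>"
    using x by simp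
  finally show ?case
    using x comm_inv_char[of x "inv x [^] (p ^ k)"] by (auto simp: m_comm Units_closed)
qed (auto simp: nat_pow_distrib frobenius_pow_add[OF p char])

text \<open>The field is the set of fixed points of the \<open>k\<close>-th iterate of Frobenius in
  the algebraic closure of the integers modulo \<open>p\<close>; its element type is that of
  \<open>alg_closure\<close> over an \<open>int\<close> ring.\<close>

theorem finite_field_exists:
  assumes "primepow q"
  obtains F :: "((int list \<times> nat) multiset \<Rightarrow> int) ring"
  where "field F" "card (carrier F) = q"
proof -
  from assms obtain p k where p: "Factorial_Ring.prime p" and k: "0 < k" and q: "q = p ^ k"
    by (auto simp: primepow_def)
  interpret res: residues_prime p "residue_ring (int p)"
    by (simp_all add: residues_prime_def p)
  let ?h = "ring.indexed_const (residue_ring (int p))"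
  define L where "L = field.alg_closure (residue_ring (int p))"
  have h: "?h \<in> ring_hom (residue_ring (int p)) L"
    unfolding L_def by (rule res.alg_closureE(2))
  interpret L: algebraic_closure L "?h ` carrier (residue_ring (int p))"
    unfolding L_def by (rule res.alg_closureE(1))
  interpret h: ring_hom_ring "residue_ring (int p)" L ?h
    by (rule ring_hom_ringI2[OF res.ring_axioms L.ring_axioms h])
  \<comment> \<open>At \<open>n = p\<close> this yields characteristic \<open>p\<close> for the
    prime field, and the embedding \<open>?h\<close> carries it to the closure.\<close>
  have "add_pow (residue_ring (int p)) n \<one>\<^bsub>residue_ring (int p)\<^esub> = int n mod int p" for n :: nat
    by (induction n) (auto simp: res.res_add_eq res.res_zero_eq res.res_one_eq mod_simps add.commute)
  then have char: "add_pow L p \<one>\<^bsub>L\<^esub> = \<zero>\<^bsub>L\<^esub>"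
    using h.hom_add_pow[of "\<one>\<^bsub>residue_ring (int p)\<^esub>" p] h.hom_zero by (simp add: res.res_zero_eq)
  let ?S = "{x \<in> carrier L. x [^]\<^bsub>L\<^esub> (p ^ k) = x}"
  have "field (L\<lparr>carrier := ?S\<rparr>)"
    using L.subfield_iff(2)[OF L.subfield_frobenius_fixpoints[OF p char]] .
  moreover have "card (carrier (L\<lparr>carrier := ?S\<rparr>)) = q"
    using L.card_frobenius_fixpoints[OF p char k] q by simp
  ultimately show ?thesis
    by (rule that)
qed


section \<open>The mediation number\<close>

text \<open>Number the field elements by \<open>e\<close> with inverse \<open>d\<close>, and
  transport the map \<open>m x + b\<close> to the numbers below \<open>q\<close>.\<close>

lemma (in field) exists_planar_function:
  assumes q: "card (carrier R) = q" "0 < q"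
  shows "\<exists>T. planar_function q T"
proof -
  have "finite (carrier R)"
    using q by (metis card.infinite less_irrefl)
  then obtain e where "bij_betw e {0..<card (carrier R)} (carrier R)"
    using ex_bij_betw_nat_finite by blast
  then have e: "bij_betw e {..<q} (carrier R)"
    by (simp add: q atLeast0LessThan)
  define d where "d = inv_into {..<q} e"
  have e_in: "e i \<in> carrier R" if "i < q" for i
    using e that by (auto simp: bij_betw_def)
  have d_in: "d x < q" if "x \<in> carrier R" for x
    using e that unfolding d_def by (metis bij_betw_def inv_into_into lessThan_iff)
  have de: "d (e i) = i" if "i < q" for i
    using e that by (simp add: d_def bij_betw_def)
  have ed: "e (d x) = x" if "x \<in> carrier R" for x
    using e that by (simp add: d_def bij_betw_def f_inv_into_f)
  define T where "T m x b = d (e m \<otimes> e x \<oplus> e b)" for m x b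
  \<comment> \<open>Solving for the intercept gives its existence and uniqueness at once, and
    reduces joining two points to making two intercepts agree.\<close>
  have T_eq: "T m x b = y \<longleftrightarrow> e b = e y \<ominus> e m \<otimes> e x"
    if "m < q" "x < q" "b < q" "y < q" for m x b y
  proof -
    have c: "e m \<in> carrier R" "e x \<in> carrier R" "e b \<in> carrier R" "e y \<in> carrier R"
      using that e_in by auto
    have "T m x b = y \<longleftrightarrow> e m \<otimes> e x \<oplus> e b = e y"
      unfolding T_def using c that de ed by (metis a_closed m_closed)
    also have "\<dots> \<longleftrightarrow> e b = e y \<ominus> e m \<otimes> e x"
      using c by (metis a_comm a_minus_def add.inv_solve_right m_closed)
    finally show ?thesis .
  qed
  have "planar_function q T"
  proof
    show "0 < q" by (rule q(2))
    show "T m x b < q" if "m < q" "x < q" "b < q" for m x b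
      unfolding T_def using that e_in by (intro d_in) auto
    show "\<exists>!b. b < q \<and> T m x b = y" if "m < q" "x < q" "y < q" for m x y
    proof (rule ex1I)
      have c: "e y \<ominus> e m \<otimes> e x \<in> carrier R"
        using that e_in by auto
      show "d (e y \<ominus> e m \<otimes> e x) < q \<and> T m x (d (e y \<ominus> e m \<otimes> e x)) = y"
        using T_eq[OF that(1,2) d_in[OF c] that(3)] ed[OF c] d_in[OF c] by simp
      show "b = d (e y \<ominus> e m \<otimes> e x)" if "b < q \<and> T m x b = y" for b
        using that T_eq[of m x b y] \<open>m < q\<close> \<open>x < q\<close> \<open>y < q\<close> de by metis
    qed
    show "\<exists>m<q. \<exists>b<q. T m x b = y \<and> T m x' b = y'"
      if xy: "x < q" "y < q" "x' < q" "y' < q" and ne: "x \<noteq> x'" for x y x' y'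
    proof -
      have c: "e x \<in> carrier R" "e x' \<in> carrier R" "e y \<in> carrier R" "e y' \<in> carrier R"
        using xy e_in by auto
      have "e x \<noteq> e x'"
        using ne xy de by metis
      then have u: "e x \<ominus> e x' \<in> Units R"
        using c by (simp add: field_Units)
      \<comment> \<open>The slope is the usual difference quotient, with nonzero denominator as
        \<open>e\<close> is injective. The intercepts computed from the two points then
        coincide.\<close>
      define \<mu> where "\<mu> = (e y \<ominus> e y') \<otimes> inv (e x \<ominus> e x')"
      have \<mu>: "\<mu> \<in> carrier R"
        unfolding \<mu>_def using u c by auto
      have "\<mu> \<otimes> (e x \<ominus> e x') = e y \<ominus> e y'"
        unfolding \<mu>_def using u c by (simp add: m_assoc)
      then have "e y = \<mu> \<otimes> (e x \<ominus> e x') \<oplus> e y'"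
        using c by (simp add: a_minus_def a_assoc l_neg)
      moreover have "(\<mu> \<otimes> (e x \<ominus> e x') \<oplus> e y') \<ominus> \<mu> \<otimes> e x = e y' \<ominus> \<mu> \<otimes> e x'"
        using c \<mu> by algebra
      ultimately have "e y \<ominus> \<mu> \<otimes> e x = e y' \<ominus> \<mu> \<otimes> e x'"
        by simp
      then have "T (d \<mu>) x (d (e y \<ominus> \<mu> \<otimes> e x)) = y" "T (d \<mu>) x' (d (e y \<ominus> \<mu> \<otimes> e x)) = y'"
        using xy c \<mu> by (simp_all add: T_eq d_in ed)
      then show ?thesis
        using c \<mu> d_in by (metis m_closed minus_closed)
    qed
  qed
  then show ?thesis by blast
qed

theorem corollary5p2:
  fixes q s :: nat
  assumes "primepow q"
    and "q\<^sup>2 + q + 2 \<le> s" and "s \<le> q\<^sup>2 + 2 * q + 2"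
  shows "int (mediation_number s) = mediation_bound s \<and> mediation_bound s = int q + 1"
proof -
  let ?M = "\<lambda>d. \<exists>D :: (nat, nat \<times> nat) pre_digraph.
    mediated D \<and> card (verts D) = s \<and> max_in_degree D = d"
  obtain F :: "((int list \<times> nat) multiset \<Rightarrow> int) ring"
    where F: "field F" "card (carrier F) = q"
    by (rule finite_field_exists[OF assms(1)])
  have "0 < q"
    using assms(1) by (rule primepow_gt_0_nat)
  then obtain T where T: "planar_function q T"
    using field.exists_planar_function[OF F] by blast
  \<comment> \<open>The projective plane supplies \<open>q\<^sup>2 + q + 1\<close> points and
    \<open>k\<close> is the number of new ones; the range of \<open>s\<close> amounts to
    \<open>1 \<le> k \<le> q + 1\<close>.\<close>
  define k where "k = s - (q\<^sup>2 + q + 1)"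
  have "0 < k" "k \<le> q + 1" "q\<^sup>2 + q + 1 + k = s"
    unfolding k_def using assms(2,3) by linarith+
  then obtain d where d: "?M d" "d \<le> q + 1"
    using planar_function.exists_mediated[OF T] by metis
  have lower: "q + 1 \<le> d'" if "?M d'" for d'
  proof (rule ccontr)
    assume "\<not> q + 1 \<le> d'"
    then have "(d' + 1) * d' \<le> (q + 1) * q"
      by (intro mult_le_mono) auto
    \<comment> \<open>With \<open>d' \<le> q\<close>, the counting bound would force
      \<open>s \<le> q\<^sup>2 + q + 1\<close>, one below the allowed range.\<close>
    moreover have "s - 1 \<le> (d' + 1) * d'"
      using that mediated_card_le assms(2) by fastforce
    ultimately show False
      using assms(2) by (simp add: power2_eq_square)
  qed
  \<comment> \<open>The construction bounds the least value from above; the least value is itself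
    attained, so \<open>lower\<close> applies to it.\<close>
  have "mediation_number s = q + 1"
    unfolding mediation_number_def
    using Least_le[of ?M, OF d(1)] lower[OF LeastI[of ?M, OF d(1)]] d(2) by linarith
  moreover have "mediation_bound s = int q + 1"
    using assms(2,3) by (intro mediation_bound_eq) auto
  ultimately show ?thesis by simp
qed

end
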